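(* Let $G$ be a finite group. Let $a,b,c$ be non-identity elements of $G$ and let $A=\langle a\rangle$, $B=\langle b\rangle$, $C=\langle c\rangle$. Suppose that $abc=1$ and $|A\cap B|=|A\cap C|=|B\cap C|=1$. Define $$T^{\circ}=\{(gA,gB,gC)\mid g\in G\},\qquad T^{\star}=\{(gA,gB,ga^{-1}C)\mid g\in G\}.$$ Then $(T^{\circ},T^{\star})$ is a latin bitrade of size $|G|$, with $|G:A|$ rows (each with $|A|$ entries), $|G:B|$ columns (each with $|B|$ entries) and $|G:C|$ entries (i.e. symbols, each occurring $|C|$ times). If, in addition, $\langle a,b,c\rangle=G$, then the latin bitrade $(T^{\circ},T^{\star})$ is primary.
   Context: Let $A_1,A_2,A_3$ be finite, non-empty, pairwise disjoint sets (of rows, columns and symbols/entries, respectively). A partial latin square is a subset $T\subseteq A_1\times A_2\times A_3$ such that (P1) if $(a_1,a_2,a_3),(b_1,b_2,b_3)\in T$ then either at most one of $a_1=b_1$, $a_2=b_2$, $a_3=b_3$ is true or all three are true; (P2) every $\alpha\in A_1\cup A_2\cup A_3$ occurs as a coordinate of some element of $T$. Here $(x,y,z)\in T$ means that symbol $z$ is in the cell in row $x$ and column $y$. A latin bitrade is a pair $(T^{\circ},T^{\star})$ of partial latin squares $T^{\circ},T^{\star}\subset A_1\times A_2\times A_3$ (same $A_1,A_2,A_3$) such that (R1) $T^{\circ}\cap T^{\star}=\emptyset$; (R2) for all $(a_1,a_2,a_3)\in T^{\circ}$ and all $r\ne s$ in $\{1,2,3\}$ there is a unique $(b_1,b_2,b_3)\in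 T^{\star}$ with $a_r=b_r$ and $a_s=b_s$; (R3) the same as (R2) with $T^{\circ}$ and $T^{\star}$ interchanged. Its size is $|T^{\circ}|=|T^{\star}|$. In the claim, $A_1,A_2,A_3$ are the sets of left cosets in $G$ of $A,B,C$ respectively. A latin bitrade $(T^{\circ},T^{\star})$ is primary if whenever $(U^{\circ},U^{\star})$ is a latin bitrade (with respect to some sets of rows, columns and symbols) with $U^{\circ}\subseteq T^{\circ}$ and $U^{\star}\subseteq T^{\star}$, then $(U^{\circ},U^{\star})=(T^{\circ},T^{\star})$. *)

theory Defs
  imports "HOL-Algebra.Algebra"
begin

datatype axis = Row | Column | Symbol

fun coord :: "axis \<Rightarrow> 'a \<times> 'a \<times> 'a \<Rightarrow> 'a" where
  "coord Row (x, y, z) = x"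
| "coord Column (x, y, z) = y"
| "coord Symbol (x, y, z) = z"

text \<open>Rows, columns and symbols live in one type, so that the requirement that the three sets be
  pairwise disjoint can be stated. The disjunction in the definition says: two elements either
  agree in at most one coordinate or agree in all three.\<close>

definition partial_latin_square ::
  "'a set \<Rightarrow> 'a set \<Rightarrow> 'a set \<Rightarrow> ('a \<times> 'a \<times> 'a) set \<Rightarrow> bool" where
  "partial_latin_square A1 A2 A3 T \<longleftrightarrow>
     finite A1 \<and> finite A2 \<and> finite A3 \<and>
     A1 \<noteq> {} \<and> A2 \<noteq> {} \<and> A3 \<noteq> {} \<and>
     A1 \<inter> A2 = {} \<and> A1 \<inter> A3 = {} \<and> A2 \<inter> A3 = {} \<and>
     T \<subseteq> A1 \<times> A2 \<times> A3 \<and>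
     (\<forall>s\<in>T. \<forall>t\<in>T.
        (\<forall>p q. coord p s = coord p t \<and> coord q s = coord q t \<longrightarrow> p = q) \<or>
        (\<forall>p. coord p s = coord p t)) \<and>
     (\<forall>\<alpha>\<in>A1 \<union> A2 \<union> A3. \<exists>t\<in>T. \<exists>p. coord p t = \<alpha>)"

definition latin_bitrade ::
  "'a set \<Rightarrow> 'a set \<Rightarrow> 'a set \<Rightarrow> ('a \<times> 'a \<times> 'a) set \<Rightarrow> ('a \<times> 'a \<times> 'a) set \<Rightarrow> bool" where
  "latin_bitrade A1 A2 A3 T1 T2 \<longleftrightarrow>
     partial_latin_square A1 A2 A3 T1 \<and>
     partial_latin_square A1 A2 A3 T2 \<and>
     T1 \<inter> T2 = {} \<and>
     (\<forall>s\<in>T1. \<forall>p q. p \<noteq> q \<longrightarrow> (\<exists>!t. t \<in> T2 \<and> coord p s = coord p t \<and> coord q s = coord q t)) \<and>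
     (\<forall>s\<in>T2. \<forall>p q. p \<noteq> q \<longrightarrow> (\<exists>!t. t \<in> T1 \<and> coord p s = coord p t \<and> coord q s = coord q t))"

definition primary_latin_bitrade ::
  "'a set \<Rightarrow> 'a set \<Rightarrow> 'a set \<Rightarrow> ('a \<times> 'a \<times> 'a) set \<Rightarrow> ('a \<times> 'a \<times> 'a) set \<Rightarrow> bool" where
  "primary_latin_bitrade A1 A2 A3 T1 T2 \<longleftrightarrow>
     latin_bitrade A1 A2 A3 T1 T2 \<and>
     (\<forall>B1 B2 B3 U1 U2.
        latin_bitrade B1 B2 B3 U1 U2 \<and> U1 \<subseteq> T1 \<and> U2 \<subseteq> T2 \<longrightarrow> U1 = T1 \<and> U2 = T2)"

text \<open>The index is counted with right cosets, as in the library's version of Lagrange's theorem.\<close>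

definition group_index :: "('a, 'b) monoid_scheme \<Rightarrow> 'a set \<Rightarrow> nat" where
  "group_index G H = card (rcosets\<^bsub>G\<^esub> H)"

end

theory Submission
  imports Defs
begin

text \<open>
  Cosets of two of the three subgroups meet in at most one point, so any two coordinates of
  \<open>(gA, gB, gC)\<close> determine \<open>g\<close>. Since \<open>abc = 1\<close>, the triple of \<open>T\<^sup>\<star>\<close> that shares two given
  coordinates with the triple of \<open>g\<close> in \<open>T\<^sup>\<circ>\<close> is the one with parameter \<open>g\<close>, \<open>ga\<close> or \<open>gb\<^sup>-\<^sup>1\<close>;
  this gives the bitrade. A sub-bitrade must be closed under these three moves and their inverses,
  hence is everything as soon as \<open>a\<close>, \<open>b\<close> and \<open>c\<close> generate \<open>G\<close>.
\<close>

text \<open>There are six ordered pairs of distinct axes; symmetry of \<open>P\<close> leaves three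
  to check.\<close>

lemma axis_neq_split:
  assumes "p \<noteq> q"
    and "P Row Column" and "P Row Symbol" and "P Column Symbol"
    and "\<And>p q. P p q \<Longrightarrow> P q p"
  shows "P p q"
  by (metis (full_types) assms axis.exhaust)

section \<open>Left cosets in an arbitrary group\<close>

context group
begin

lemma l_coset_eq_iff:
  assumes "subgroup H G" "g \<in> carrier G" "h \<in> carrier G"
  shows "g <# H = h <# H \<longleftrightarrow> inv g \<otimes> h \<in> H"
proof
  assume "g <# H = h <# H"
  then have "h \<in> g <# H" using lcos_self[OF assms(3,1)] by simp
  then show "inv g \<otimes> h \<in> H"
    by (rule subgroup.lcos_module_imp[OF assms(1) is_group assms(2)])
next
  assume "inv g \<otimes> h \<in> H"
  then have "h \<in> g <# H"
    by (rule subgroup.lcos_module_rev[OF assms(1) is_group assms(2,3)])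
  then show "g <# H = h <# H"
    using assms(2,1) by (rule l_repr_independence)
qed

lemma l_coset_mult_mem:
  assumes "subgroup H G" "g \<in> carrier G" "h \<in> H"
  shows "(g \<otimes> h) <# H = g <# H"
proof -
  have "g \<otimes> h \<in> g <# H" using assms(3) by (auto simp: l_coset_def)
  then show ?thesis using l_repr_independence[OF _ assms(2,1)] by simp
qed

text \<open>A coset remembers its subgroup: the common set contains \<open>g\<close>, so it is
  \<open>g\<close> times \<open>K\<close> as well as \<open>g\<close> times \<open>H\<close>, and
  translating back by \<open>inv g\<close> recovers both. This is what keeps rows, columns and
  symbols apart.\<close>

lemma subgroup_eq_if_l_coset_eq:
  assumes "subgroup H G" "subgroup K G" "g \<in> carrier G" "h \<in> carrier G" "g <# H = h <# K"
  shows "H = K"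
proof -
  have "g \<in> h <# K" using lcos_self[OF assms(3,1)] assms(5) by simp
  then have "g <# H = g <# K" using l_repr_independence[OF _ assms(4,2)] assms(5) by simp
  then have "inv g <# (g <# H) = inv g <# (g <# K)" by simp
  then show ?thesis
    using assms(1-3) by (simp add: lcos_m_assoc subgroup.subset lcos_mult_one)
qed

text \<open>Both versions of Lagrange's theorem give the order of the group; the positive factor
  \<open>card H\<close> cancels.\<close>

lemma card_lcosets_eq_index:
  assumes "finite (carrier G)" "subgroup H G"
  shows "card (lcosets H) = group_index G H"
proof -
  have "card H > 0"
    using assms subgroup.one_closed subgroup.subset by (metis card_gt_0_iff empty_iff finite_subset)
  moreover have "card (lcosets H) * card H = card (rcosets H) * card H"
    using assms l_lagrange lagrange by metis
  ultimately show ?thesis by (simp add: group_index_def)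
qed

end

section \<open>Three cyclic subgroups with pairwise trivial intersection, and the two families of
  triples\<close>

locale coset_bitrade = group G for G (structure) +
  fixes a b c A B C
  assumes fin: "finite (carrier G)"
    and abc_carrier [simp]: "a \<in> carrier G" "b \<in> carrier G" "c \<in> carrier G"
    and a_neq_one: "a \<noteq> \<one>" and b_neq_one: "b \<noteq> \<one>" and c_neq_one: "c \<noteq> \<one>"
    and A_def: "A = generate G {a}" and B_def: "B = generate G {b}" and C_def: "C = generate G {c}"
    and abc: "a \<otimes> b \<otimes> c = \<one>"
    and card_Int: "card (A \<inter> B) = 1" "card (A \<inter> C) = 1" "card (B \<inter> C) = 1"
begin

fun axis_subgroup where
  "axis_subgroup Row = A"
| "axis_subgroup Column = B"
| "axis_subgroup Symbol = C"

definition circ where "circ g = (g <# A, g <# B, g <# C)"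

definition star where "star g = (g <# A, g <# B, (g \<otimes> inv a) <# C)"

text \<open>The right factor that turns the parameter of a \<open>circ\<close> triple into that of
  the \<open>star\<close> triple agreeing with it on the axes \<open>p\<close> and \<open>q\<close>.
  Testing membership in \<open>{p, q}\<close> makes it symmetric in the two axes.\<close>

definition move where
  "move p q = (if Symbol \<notin> {p, q} then \<one> else if Row \<in> {p, q} then a else inv b)"

lemma move_carrier [simp]: "move p q \<in> carrier G"
  by (simp add: move_def)

lemma subgroup_ABC: "subgroup A G" "subgroup B G" "subgroup C G"
  by (simp_all add: A_def B_def C_def generate_is_subgroup)

lemma subgroup_axis: "subgroup (axis_subgroup p) G"
  by (cases p) (simp_all add: subgroup_ABC)

lemma gen_mem: "a \<in> A" "b \<in> B" "c \<in> C"
  by (simp_all add: A_def B_def C_def generate.incl)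

lemma coord_circ: "coord p (circ g) = g <# axis_subgroup p"
  by (cases p) (simp_all add: circ_def)

lemma axis_subgroup_Int:
  assumes "p \<noteq> q"
  shows "axis_subgroup p \<inter> axis_subgroup q = {\<one>}"
proof -
  have "card (axis_subgroup p \<inter> axis_subgroup q) = 1"
    using assms by (rule axis_neq_split) (simp_all add: card_Int Int_commute)
  moreover have "\<one> \<in> axis_subgroup p \<inter> axis_subgroup q"
    using subgroup_axis subgroup.one_closed by blast
  ultimately show ?thesis by (metis card_1_singletonE singletonD)
qed

text \<open>Equal subgroups would coincide with their trivial intersection, yet each contains a
  non-identity generator.\<close>

lemma axis_subgroup_neq:
  assumes "p \<noteq> q"
  shows "axis_subgroup p \<noteq> axis_subgroup q"
proof -
  have "axis_subgroup p \<noteq> {\<one>}"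
    using gen_mem a_neq_one b_neq_one c_neq_one by (cases p) auto
  then show ?thesis using axis_subgroup_Int[OF assms] by auto
qed

lemma lcosets_disjoint:
  assumes "p \<noteq> q"
  shows "lcosets (axis_subgroup p) \<inter> lcosets (axis_subgroup q) = {}"
proof (rule ccontr)
  assume "lcosets (axis_subgroup p) \<inter> lcosets (axis_subgroup q) \<noteq> {}"
  then obtain g h where "g \<in> carrier G" "h \<in> carrier G" "g <# axis_subgroup p = h <# axis_subgroup q"
    by (auto simp: LCOSETS_def)
  then have "axis_subgroup p = axis_subgroup q"
    using subgroup_eq_if_l_coset_eq[OF subgroup_axis subgroup_axis] by simp
  then show False using axis_subgroup_neq[OF assms] by simp
qed

section \<open>How two coordinates determine a parameter\<close>

lemma circ_determined:
  assumes "p \<noteq> q" "g \<in> carrier G" "h \<in> carrier G"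
    and "coord p (circ g) = coord p (circ h)" "coord q (circ g) = coord q (circ h)"
  shows "g = h"
proof -
  have "inv g \<otimes> h \<in> axis_subgroup p \<inter> axis_subgroup q"
    using assms by (simp add: coord_circ l_coset_eq_iff[OF subgroup_axis])
  then have "inv g \<otimes> h = \<one>" using axis_subgroup_Int[OF assms(1)] by simp
  moreover have "h = g \<otimes> (inv g \<otimes> h)" using assms(2,3) by (simp add: m_assoc[symmetric])
  ultimately show ?thesis using assms(2) by simp
qed

lemma inv_b_inv_a: "inv b \<otimes> inv a = c"
proof -
  have "inv (a \<otimes> b) = c"
    using abc inv_comm[of "a \<otimes> b" c] inv_equality[of c "a \<otimes> b"] by simp
  then show ?thesis by (simp add: inv_mult_group)
qed

text \<open>For Row and Symbol, right multiplication by \<open>a\<close> fixes the coset of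
  \<open>A\<close> and cancels the \<open>inv a\<close> in the symbol. For Column and Symbol,
  \<open>inv b\<close> is absorbed by \<open>B\<close>, while
  \<open>inv b \<otimes> inv a = c\<close> is absorbed by \<open>C\<close>.\<close>

lemma star_move:
  assumes "p \<noteq> q" "g \<in> carrier G"
  shows "coord p (star (g \<otimes> move p q)) = coord p (circ g)
    \<and> coord q (star (g \<otimes> move p q)) = coord q (circ g)"
  using assms(1)
proof (rule axis_neq_split)
  have "(g \<otimes> a) \<otimes> inv a = g" using assms by (simp add: m_assoc)
  then show "coord Row (star (g \<otimes> move Row Symbol)) = coord Row (circ g)
    \<and> coord Symbol (star (g \<otimes> move Row Symbol)) = coord Symbol (circ g)"
    using assms l_coset_mult_mem[OF subgroup_ABC(1) _ gen_mem(1)]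
    by (simp add: star_def circ_def move_def)
  have "(g \<otimes> inv b) \<otimes> inv a = g \<otimes> c" using assms by (simp add: m_assoc inv_b_inv_a)
  moreover have "inv b \<in> B" using subgroup.m_inv_closed[OF subgroup_ABC(2) gen_mem(2)] .
  ultimately show "coord Column (star (g \<otimes> move Column Symbol)) = coord Column (circ g)
    \<and> coord Symbol (star (g \<otimes> move Column Symbol)) = coord Symbol (circ g)"
    using assms l_coset_mult_mem[OF subgroup_ABC(2), of g "inv b"]
      l_coset_mult_mem[OF subgroup_ABC(3) _ gen_mem(3)]
    by (simp add: star_def circ_def move_def)
next
  show "coord Row (star (g \<otimes> move Row Column)) = coord Row (circ g)
    \<and> coord Column (star (g \<otimes> move Row Column)) = coord Column (circ g)"
    using assms by (simp add: star_def circ_def move_def)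
next
  fix p q
  assume "coord p (star (g \<otimes> move p q)) = coord p (circ g)
    \<and> coord q (star (g \<otimes> move p q)) = coord q (circ g)"
  moreover have "move q p = move p q" by (auto simp: move_def)
  ultimately show "coord q (star (g \<otimes> move q p)) = coord q (circ g)
    \<and> coord p (star (g \<otimes> move q p)) = coord p (circ g)" by simp
qed

lemma circ_star_agree_iff:
  assumes "p \<noteq> q" "g \<in> carrier G" "h \<in> carrier G"
  shows "coord p (circ g) = coord p (star h) \<and> coord q (circ g) = coord q (star h)
    \<longleftrightarrow> h = g \<otimes> move p q" (is "?agree \<longleftrightarrow> _")
proof
  \<comment> \<open>\<open>star h\<close> agrees with \<open>circ ?k\<close> on both axes. If it
    also agrees with \<open>circ g\<close>, then \<open>circ g\<close> and \<open>circ ?k\<close>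
    share two coordinates, so \<open>g = ?k\<close>.\<close>
  let ?k = "h \<otimes> inv (move p q)"
  have k: "?k \<in> carrier G" "?k \<otimes> move p q = h" using assms by (simp_all add: m_assoc)
  assume ?agree
  then have "g = ?k"
    using star_move[OF assms(1) k(1)] k assms by (intro circ_determined[of p q]) simp_all
  then show "h = g \<otimes> move p q" using k by simp
next
  assume "h = g \<otimes> move p q"
  then show ?agree using star_move[OF assms(1,2)] by simp
qed

text \<open>Reduces to the \<open>circ\<close> family: \<open>star g\<close> and
  \<open>star h\<close> both agree on \<open>p\<close> and \<open>q\<close> with one triple
  \<open>circ ?k\<close>, and such a partner is unique.\<close>

lemma star_determined:
  assumes "p \<noteq> q" "g \<in> carrier G" "h \<in> carrier G"
    and "coord p (star g) = coord p (star h)" "coord q (star g) = coord q (star h)"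
  shows "g = h"
proof -
  let ?k = "g \<otimes> inv (move p q)"
  have k: "?k \<in> carrier G" "?k \<otimes> move p q = g" using assms by (simp_all add: m_assoc)
  then have "coord p (circ ?k) = coord p (star h) \<and> coord q (circ ?k) = coord q (star h)"
    using assms circ_star_agree_iff[OF assms(1) k(1) assms(2)] by simp
  then have "h = ?k \<otimes> move p q"
    using circ_star_agree_iff[OF assms(1) k(1) assms(3)] by blast
  then show ?thesis using k by simp
qed

section \<open>Parametrizations and the number of triples in each row, column and symbol\<close>

lemma inj_circ: "inj_on circ (carrier G)"
  by (rule inj_onI) (rule circ_determined[of Row Column], simp_all)

lemma inj_star: "inj_on star (carrier G)"
  by (rule inj_onI) (rule star_determined[of Row Column], simp_all)

lemma image_star_move:
  "(\<lambda>g. star (g \<otimes> move p q)) ` carrier G = star ` carrier G"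
proof
  show "star ` carrier G \<subseteq> (\<lambda>g. star (g \<otimes> move p q)) ` carrier G"
  proof
    fix t assume "t \<in> star ` carrier G"
    then obtain h where h: "h \<in> carrier G" "t = star h" by blast
    then have "t = star (h \<otimes> inv (move p q) \<otimes> move p q)" by (simp add: m_assoc)
    then show "t \<in> (\<lambda>g. star (g \<otimes> move p q)) ` carrier G"
      by (rule image_eqI) (simp add: h)
  qed
qed auto

text \<open>The symbol of \<open>star g\<close> is the coset of \<open>g \<otimes> inv a\<close>,
  not of \<open>g\<close>. Shifting the parameter by a move removes this discrepancy on any chosen
  axis \<open>p\<close>, so that both squares can be treated alike one axis at a time.\<close>

lemma parametrization:
  assumes "T \<in> {circ ` carrier G, star ` carrier G}"
  obtains f where "T = f ` carrier G" "inj_on f (carrier G)"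
    "\<And>g. g \<in> carrier G \<Longrightarrow> coord p (f g) = g <# axis_subgroup p"
proof (cases "T = circ ` carrier G")
  case True
  then show ?thesis using that inj_circ coord_circ by blast
next
  case False
  then have T: "T = star ` carrier G" using assms by simp
  \<comment> \<open>Any second axis will do: the shifted \<open>star\<close> triple agrees with
    \<open>circ g\<close> on \<open>p\<close> whichever \<open>q\<close> is taken.\<close>
  obtain q where "p \<noteq> q" by (metis axis.distinct(1))
  let ?f = "\<lambda>g. star (g \<otimes> move p q)"
  have "inj_on ?f (carrier G)"
    by (rule inj_onI) (use inj_star in \<open>auto dest!: inj_onD\<close>)
  moreover have "\<And>g. g \<in> carrier G \<Longrightarrow> coord p (?f g) = g <# axis_subgroup p"
    using star_move[OF \<open>p \<noteq> q\<close>] coord_circ by simp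
  ultimately show ?thesis using that[of ?f] T image_star_move by simp
qed

lemma card_line:
  assumes "T \<in> {circ ` carrier G, star ` carrier G}" and "x \<in> lcosets (axis_subgroup p)"
  shows "card {t \<in> T. coord p t = x} = card (axis_subgroup p)"
proof -
  obtain f where f: "T = f ` carrier G" "inj_on f (carrier G)"
    "\<And>g. g \<in> carrier G \<Longrightarrow> coord p (f g) = g <# axis_subgroup p"
    using parametrization[OF assms(1), of p] by metis
  obtain k where k: "k \<in> carrier G" "x = k <# axis_subgroup p"
    using assms(2) by (auto simp: LCOSETS_def)
  have sub: "x \<subseteq> carrier G"
    using assms(2) subgroup.lcosets_carrier[OF subgroup_axis is_group] by blast
  \<comment> \<open>The parameters of the triples on the line \<open>x\<close> are exactly the
    elements of the coset \<open>x\<close>, so injectivity of \<open>f\<close> reduces the count to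
    the size of a coset.\<close>
  have "g <# axis_subgroup p = x \<longleftrightarrow> g \<in> x" if "g \<in> carrier G" for g
    using that k lcos_self l_repr_independence subgroup_axis by metis
  then have "{t \<in> T. coord p t = x} = f ` x"
    using f(1,3) sub by (auto; blast)
  then have "card {t \<in> T. coord p t = x} = card x"
    using f(2) sub by (metis card_image inj_on_subset)
  then show ?thesis
    using l_card_cosets_equal[OF assms(2) _ fin] subgroup_axis subgroup.subset by metis
qed

section \<open>The partial latin square and bitrade conditions\<close>

lemma partial_latin_square:
  assumes T: "T \<in> {circ ` carrier G, star ` carrier G}"
  shows "partial_latin_square (lcosets A) (lcosets B) (lcosets C) T"
proof -
  have fin_lcosets: "finite (lcosets H)" for H
    using fin by (simp add: LCOSETS_def)
  have nonempty: "lcosets H \<noteq> {}" for H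
    by (auto simp: LCOSETS_def)
  have coord_mem: "coord p t \<in> lcosets (axis_subgroup p)" if "t \<in> T" for p t
  proof -
    obtain f where "T = f ` carrier G"
      "\<And>g. g \<in> carrier G \<Longrightarrow> coord p (f g) = g <# axis_subgroup p"
      using parametrization[OF T, of p] by metis
    then show ?thesis using that by (auto simp: LCOSETS_def)
  qed
  have sub: "T \<subseteq> (lcosets A) \<times> (lcosets B) \<times> (lcosets C)"
  proof
    fix t assume "t \<in> T"
    then show "t \<in> (lcosets A) \<times> (lcosets B) \<times> (lcosets C)"
      using coord_mem[of t Row] coord_mem[of t Column] coord_mem[of t Symbol]
      by (cases t) simp
  qed
  have determined: "s = t"
    if "s \<in> T" "t \<in> T" "p \<noteq> q" "coord p s = coord p t" "coord q s = coord q t" for s t p q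
  proof -
    consider "T = circ ` carrier G" | "T = star ` carrier G" using T by blast
    then show ?thesis
    proof cases
      case 1
      then obtain g h where "g \<in> carrier G" "h \<in> carrier G" "s = circ g" "t = circ h"
        using \<open>s \<in> T\<close> \<open>t \<in> T\<close> by blast
      then show ?thesis using circ_determined[OF \<open>p \<noteq> q\<close>, of g h] that by simp
    next
      case 2
      then obtain g h where "g \<in> carrier G" "h \<in> carrier G" "s = star g" "t = star h"
        using \<open>s \<in> T\<close> \<open>t \<in> T\<close> by blast
      then show ?thesis using star_determined[OF \<open>p \<noteq> q\<close>, of g h] that by simp
    qed
  qed
  have occurs: "\<exists>t\<in>T. coord p t = x" if "x \<in> lcosets (axis_subgroup p)" for p x
  proof -
    obtain f where "T = f ` carrier G"
      "\<And>g. g \<in> carrier G \<Longrightarrow> coord p (f g) = g <# axis_subgroup p"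
      using parametrization[OF T, of p] by metis
    then show ?thesis using that by (auto simp: LCOSETS_def)
  qed
  \<comment> \<open>If the first alternative fails, two distinct axes agree, hence
    \<open>s = t\<close> and all coordinates agree.\<close>
  have "(\<forall>p q. coord p s = coord p t \<and> coord q s = coord q t \<longrightarrow> p = q)
    \<or> (\<forall>p. coord p s = coord p t)" if "s \<in> T" "t \<in> T" for s t
    using determined[OF that] by blast
  moreover have "\<exists>t\<in>T. \<exists>p. coord p t = x" if "x \<in> lcosets A \<union> lcosets B \<union> lcosets C" for x
    using that occurs[of x Row] occurs[of x Column] occurs[of x Symbol] by auto
  ultimately show ?thesis
    unfolding partial_latin_square_def
    using fin_lcosets nonempty sub lcosets_disjoint[of Row Column] lcosets_disjoint[of Row Symbol]
      lcosets_disjoint[of Column Symbol]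
    by (intro conjI ballI) simp_all
qed

text \<open>A common triple would agree on every pair of axes at once, so its two parameters would
  differ both by the identity and by \<open>a\<close>.\<close>

lemma circ_star_disjoint: "circ ` carrier G \<inter> star ` carrier G = {}"
proof (rule ccontr)
  assume "circ ` carrier G \<inter> star ` carrier G \<noteq> {}"
  then obtain g h where gh: "g \<in> carrier G" "h \<in> carrier G" "circ g = star h" by blast
  have "h = g \<otimes> move Row Column" "h = g \<otimes> move Row Symbol"
    using circ_star_agree_iff[OF _ gh(1,2)] gh(3) by auto
  then have "g \<otimes> a = g \<otimes> \<one>" by (simp add: move_def)
  then show False using gh a_neq_one l_cancel abc_carrier one_closed by blast
qed

lemma latin_bitrade:
  "latin_bitrade (lcosets A) (lcosets B) (lcosets C) (circ ` carrier G) (star ` carrier G)"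
proof -
  have "\<exists>!t. t \<in> star ` carrier G \<and> coord p s = coord p t \<and> coord q s = coord q t"
    if "s \<in> circ ` carrier G" "p \<noteq> q" for s p q
  proof -
    obtain g where g: "g \<in> carrier G" "s = circ g" using \<open>s \<in> circ ` carrier G\<close> by blast
    show ?thesis
    proof (rule ex1I[of _ "star (g \<otimes> move p q)"])
      show "star (g \<otimes> move p q) \<in> star ` carrier G
        \<and> coord p s = coord p (star (g \<otimes> move p q)) \<and> coord q s = coord q (star (g \<otimes> move p q))"
        using g circ_star_agree_iff[OF that(2), of g "g \<otimes> move p q"] by simp
    next
      fix t assume t: "t \<in> star ` carrier G \<and> coord p s = coord p t \<and> coord q s = coord q t"
      then obtain h where h: "h \<in> carrier G" "t = star h" by blast
      then show "t = star (g \<otimes> move p q)"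
        using circ_star_agree_iff[OF that(2) g(1) h(1)] t g(2) by simp
    qed
  qed
  moreover have "\<exists>!t. t \<in> circ ` carrier G \<and> coord p s = coord p t \<and> coord q s = coord q t"
    if "s \<in> star ` carrier G" "p \<noteq> q" for s p q
  proof -
    obtain h where h: "h \<in> carrier G" "s = star h" using \<open>s \<in> star ` carrier G\<close> by blast
    \<comment> \<open>The partner of \<open>star h\<close> is found by undoing the move.\<close>
    let ?k = "h \<otimes> inv (move p q)"
    have k: "?k \<in> carrier G" "?k \<otimes> move p q = h" using h by (simp_all add: m_assoc)
    have *: "coord p s = coord p (circ ?k) \<and> coord q s = coord q (circ ?k)"
      using star_move[OF that(2) k(1)] k h by simp
    show ?thesis
    proof (rule ex1I[of _ "circ ?k"])
      show "circ ?k \<in> circ ` carrier G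
        \<and> coord p s = coord p (circ ?k) \<and> coord q s = coord q (circ ?k)"
        using k * by blast
    next
      fix t assume t: "t \<in> circ ` carrier G \<and> coord p s = coord p t \<and> coord q s = coord q t"
      then obtain g where g: "g \<in> carrier G" "t = circ g" by blast
      then show "t = circ ?k" using circ_determined[OF that(2) g(1) k(1)] t * by simp
    qed
  qed
  ultimately show ?thesis
    unfolding latin_bitrade_def
    using partial_latin_square[of "circ ` carrier G"] partial_latin_square[of "star ` carrier G"]
      circ_star_disjoint by simp
qed

section \<open>Primality when \<open>a\<close>, \<open>b\<close> and \<open>c\<close> generate the
  group\<close>

lemma primary:
  assumes gen: "generate G {a, b, c} = carrier G"
  shows "primary_latin_bitrade (lcosets A) (lcosets B) (lcosets C)
    (circ ` carrier G) (star ` carrier G)"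
proof -
  have "U1 = circ ` carrier G \<and> U2 = star ` carrier G"
    if bitrade: "latin_bitrade B1 B2 B3 U1 U2"
      and sub: "U1 \<subseteq> circ ` carrier G" "U2 \<subseteq> star ` carrier G" for B1 B2 B3 U1 U2
  proof -
    have R2: "\<And>s p q. s \<in> U1 \<Longrightarrow> p \<noteq> q \<Longrightarrow> \<exists>t\<in>U2. coord p s = coord p t \<and> coord q s = coord q t"
      and R3: "\<And>s p q. s \<in> U2 \<Longrightarrow> p \<noteq> q \<Longrightarrow> \<exists>t\<in>U1. coord p s = coord p t \<and> coord q s = coord q t"
      using bitrade unfolding latin_bitrade_def by metis+
    \<comment> \<open>The partner that the sub-bitrade provides lies in the full \<open>star\<close>
      family, where \<open>circ_star_agree_iff\<close> leaves only one candidate.\<close>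
    have U2_mem: "star (g \<otimes> move p q) \<in> U2"
      if "g \<in> carrier G" "circ g \<in> U1" "p \<noteq> q" for g p q
    proof -
      obtain t where t: "t \<in> U2" "coord p (circ g) = coord p t" "coord q (circ g) = coord q t"
        using R2[OF \<open>circ g \<in> U1\<close> \<open>p \<noteq> q\<close>] by metis
      then obtain h where "h \<in> carrier G" "t = star h" using sub(2) by blast
      then show ?thesis using circ_star_agree_iff[OF \<open>p \<noteq> q\<close> \<open>g \<in> carrier G\<close>, of h] t by simp
    qed
    have U1_mem: "circ g \<in> U1"
      if "g \<in> carrier G" "star (g \<otimes> move p q) \<in> U2" "p \<noteq> q" for g p q
    proof -
      obtain t where t: "t \<in> U1" "coord p t = coord p (star (g \<otimes> move p q))"
        "coord q t = coord q (star (g \<otimes> move p q))"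
        using R3[OF \<open>star (g \<otimes> move p q) \<in> U2\<close> \<open>p \<noteq> q\<close>] by metis
      then obtain h where h: "h \<in> carrier G" "t = circ h" using sub(1) by blast
      then have "h = g"
        using circ_determined[OF \<open>p \<noteq> q\<close> _ \<open>g \<in> carrier G\<close>] star_move[OF \<open>p \<noteq> q\<close> \<open>g \<in> carrier G\<close>] t
        by simp
      then show ?thesis using t h by simp
    qed
    have star_iff: "star (g \<otimes> move p q) \<in> U2 \<longleftrightarrow> circ g \<in> U1"
      if "g \<in> carrier G" "p \<noteq> q" for g p q
      using U1_mem U2_mem that by blast
    have circ_iff_star: "circ g \<in> U1 \<longleftrightarrow> star g \<in> U2" if "g \<in> carrier G" for g
      using star_iff[OF that, of Row Column] that by (simp add: move_def)
    \<comment> \<open>One step through \<open>U2\<close> and back: the Row-Symbol move leads from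
      \<open>circ g\<close> to \<open>star (g \<otimes> a)\<close>, and the trivial Row-Column move
      returns to \<open>circ (g \<otimes> a)\<close>.\<close>
    have circ_a: "circ (g \<otimes> a) \<in> U1 \<longleftrightarrow> circ g \<in> U1" if "g \<in> carrier G" for g
      using star_iff[OF that, of Row Symbol] circ_iff_star that by (simp add: move_def)
    have circ_inv_b: "circ (g \<otimes> inv b) \<in> U1 \<longleftrightarrow> circ g \<in> U1" if "g \<in> carrier G" for g
      using star_iff[OF that, of Column Symbol] circ_iff_star that by (simp add: move_def)
    have circ_inv: "circ (g \<otimes> inv x) \<in> U1 \<longleftrightarrow> circ g \<in> U1"
      if "\<And>g. g \<in> carrier G \<Longrightarrow> circ (g \<otimes> x) \<in> U1 \<longleftrightarrow> circ g \<in> U1"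
        "x \<in> carrier G" "g \<in> carrier G" for g x
      using that(1)[of "g \<otimes> inv x"] that(2,3) by (simp add: m_assoc)
    have circ_b: "circ (g \<otimes> b) \<in> U1 \<longleftrightarrow> circ g \<in> U1" if "g \<in> carrier G" for g
      using circ_inv[OF circ_inv_b] that by simp
    have circ_c: "circ (g \<otimes> c) \<in> U1 \<longleftrightarrow> circ g \<in> U1" if "g \<in> carrier G" for g
    proof -
      have "g \<otimes> c = g \<otimes> inv b \<otimes> inv a" using that by (simp add: m_assoc inv_b_inv_a)
      then show ?thesis using circ_inv_b circ_inv[OF circ_a] that by simp
    qed
    have invariant: "circ (g \<otimes> x) \<in> U1 \<longleftrightarrow> circ g \<in> U1"
      if "x \<in> generate G {a, b, c}" "g \<in> carrier G" for x g
      using that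
    \<comment> \<open>The base point \<open>g\<close> must vary: for a product, the hypothesis on
      \<open>h2\<close> is applied at \<open>g \<otimes> h1\<close>. There \<open>gen\<close> serves
      to place both factors in the carrier.\<close>
    proof (induction arbitrary: g rule: generate.induct)
      case (incl h)
      then show ?case using circ_a circ_b circ_c by blast
    next
      case (inv h)
      then show ?case
        using circ_inv[OF circ_a] circ_inv[OF circ_b] circ_inv[OF circ_c] by auto
    next
      case (eng h1 h2)
      then show ?case using gen by (simp add: m_assoc[symmetric])
    qed simp
    obtain k where k: "k \<in> carrier G" "circ k \<in> U1"
    proof -
      \<comment> \<open>A starting point exists because the row set is non-empty and each of its
        elements occurs in some triple of \<open>U1\<close>.\<close>
      have "B1 \<noteq> {}" "\<forall>\<alpha>\<in>B1 \<union> B2 \<union> B3. \<exists>t\<in>U1. \<exists>p. coord p t = \<alpha>"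
        using bitrade unfolding latin_bitrade_def partial_latin_square_def by simp_all
      then have "U1 \<noteq> {}" by auto
      then show ?thesis using that sub(1) by blast
    qed
    have "circ g \<in> U1" if "g \<in> carrier G" for g
    proof -
      \<comment> \<open>Every \<open>g\<close> is reached from \<open>k\<close> by right
        multiplication with an element of the generated subgroup, which is all of
        \<open>G\<close>.\<close>
      have "k \<otimes> (inv k \<otimes> g) = g" using k that by (simp add: m_assoc[symmetric])
      then show ?thesis using invariant[of "inv k \<otimes> g" k] gen k that by simp
    qed
    then show ?thesis using circ_iff_star sub by auto
  qed
  then show ?thesis
    unfolding primary_latin_bitrade_def using latin_bitrade by blast
qed

end

theorem theorem2p14:
  fixes G :: "('g, 'm) monoid_scheme" (structure)
    and a b c :: 'g
    and A B C :: "'g set"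
    and T1 T2 :: "('g set \<times> 'g set \<times> 'g set) set"
  assumes "group G" and "finite (carrier G)"
    and "a \<in> carrier G" and "b \<in> carrier G" and "c \<in> carrier G"
    and "a \<noteq> \<one>" and "b \<noteq> \<one>" and "c \<noteq> \<one>"
    and "A = generate G {a}" and "B = generate G {b}" and "C = generate G {c}"
    and "a \<otimes> b \<otimes> c = \<one>"
    and "card (A \<inter> B) = 1" and "card (A \<inter> C) = 1" and "card (B \<inter> C) = 1"
    and "T1 = {(g <# A, g <# B, g <# C) | g. g \<in> carrier G}"
    and "T2 = {(g <# A, g <# B, (g \<otimes> inv a) <# C) | g. g \<in> carrier G}"
  shows "latin_bitrade (lcosets A) (lcosets B) (lcosets C) T1 T2 \<and>
    card T1 = order G \<and> card T2 = order G \<and>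
    card (lcosets A) = group_index G A \<and>
    card (lcosets B) = group_index G B \<and>
    card (lcosets C) = group_index G C \<and>
    (\<forall>T\<in>{T1, T2}.
      (\<forall>x\<in>lcosets A. card {t \<in> T. coord Row t = x} = card A) \<and>
      (\<forall>y\<in>lcosets B. card {t \<in> T. coord Column t = y} = card B) \<and>
      (\<forall>z\<in>lcosets C. card {t \<in> T. coord Symbol t = z} = card C)) \<and>
    (generate G {a, b, c} = carrier G \<longrightarrow>
      primary_latin_bitrade (lcosets A) (lcosets B) (lcosets C) T1 T2)"
proof -
  interpret coset_bitrade G a b c A B C
    using assms by (simp add: coset_bitrade_def coset_bitrade_axioms_def)
  have T: "T1 = circ ` carrier G" "T2 = star ` carrier G"
    using assms(16,17) by (auto simp: circ_def star_def)
  have "card T1 = order G" "card T2 = order G"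
    unfolding T order_def using inj_circ inj_star by (simp_all add: card_image)
  then show ?thesis
    using T latin_bitrade primary card_lcosets_eq_index[OF fin] subgroup_ABC
      card_line[of _ _ Row] card_line[of _ _ Column] card_line[of _ _ Symbol]
    by simp
qed

end
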